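(* Let $f:\mathbb{B}^n\to\mathbb{B}^n$ be a $K$-quasiconformal self-map ($K\ge 1$) with no fixed point in $\mathbb{B}^n$. Suppose that there exist a point $\tau\in\partial\mathbb{B}^n$, a number $\alpha\in(0,1)$, and $\beta>0$ such that: (i) for every $z\in\mathbb{B}^n$, the forward orbit $f^{\circ k}(z)$ converges to $\tau$ non-tangentially, in the sense that it converges to $\tau$ and eventually remains in some Korányi region $K(\tau,M)$; (ii) as $z\to\tau$ non-tangentially, $$\frac{|1-\langle f(z),\tau\rangle|}{|1-\langle z,\tau\rangle|}=\alpha\left(1+O\!\left(|1-\langle z,\tau\rangle|^\beta\right)\right).$$ Then, for every $z_0,w\in\mathbb{B}^n$, $$\rho_{\mathbb{B}^n}\bigl(f^{\circ k}(z_0),w\bigr)=k\log\frac{1}{\alpha}+O(1),\qquad k\to\infty.$$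
   Context: $\mathbb{B}^n=\{z\in\mathbb{C}^n:|z|<1\}$, $\langle z,w\rangle=\sum_{j=1}^n z_j\overline{w_j}$. $f^{\circ k}$ denotes the $k$-th iterate. The distance on the ball is $\rho_{\mathbb{B}^n}(z,w)=\inf_\gamma\int_\gamma\frac{2|d\xi|}{1-|\xi|^2}$ over rectifiable curves in $\mathbb{B}^n$ joining $z$ to $w$; equivalently $\sinh\frac{\rho_{\mathbb{B}^n}(z,w)}{2}=\frac{|z-w|}{\sqrt{1-|z|^2}\sqrt{1-|w|^2}}$. For $\tau\in\partial\mathbb{B}^n$, $M>1$, the Korányi region is $K(\tau,M)=\{z\in\mathbb{B}^n:|1-\langle z,\tau\rangle|<M(1-|z|)\}$. "As $z\to\tau$ non-tangentially" means as $z\to\tau$ within $K(\tau,M)$, for every $M>1$ (implied constants may depend on $M$). A homeomorphism $f:\mathbb{B}^n\to\mathbb{B}^n$ is $K$-quasiconformal, $K\ge1$, if, identifying $\mathbb{C}^n$ with $\mathbb{R}^{2n}$, $f\in W^{1,2n}_{\mathrm{loc}}(\mathbb{B}^n)$ and $\|Df(z)\|^{2n}\le K J_f(z)$ for almost every $z\in\mathbb{B}^n$, where $\|Df(z)\|$ is the operator norm of the real differential and $J_f$ the Jacobian determinant; $f$ is assumed orientation preserving. $O(1)$ denotes a quantity bounded independently of $k$ (possibly depending on $f,z_0,w$). *)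

theory Defs
  imports "HOL-Analysis.Analysis" "HOL-Homology.Homology" "HOL-Library.Landau_Symbols"
begin

section \<open>Curves and the hyperbolic distance of the ball\<close>

text \<open>\<open>\<complex>\<^sup>n\<close> is the type \<open>complex^'n\<close> with its Euclidean norm; the unit ball is \<open>ball 0 1\<close>.\<close>

definition herm :: "complex^'n \<Rightarrow> complex^'n \<Rightarrow> complex" where
  "herm z w = (\<Sum>j\<in>UNIV. z $ j * cnj (w $ j))"

text \<open>Lengths of the inscribed polygons of the curve \<open>\<gamma>\<close> restricted to \<open>{a..b}\<close>.\<close>

definition polygon_lengths :: "(real \<Rightarrow> 'a::metric_space) \<Rightarrow> real \<Rightarrow> real \<Rightarrow> real set" where
  "polygon_lengths \<gamma> a b =
     {\<Sum>i<m. dist (\<gamma> (t i)) (\<gamma> (t (Suc i))) | (m::nat) (t::nat \<Rightarrow> real). mono t \<and> range t \<subseteq> {a..b}}"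

definition rectifiable_path :: "(real \<Rightarrow> 'a::metric_space) \<Rightarrow> bool" where
  "rectifiable_path \<gamma> \<longleftrightarrow> path \<gamma> \<and> bdd_above (polygon_lengths \<gamma> 0 1)"

definition arc_length :: "(real \<Rightarrow> 'a::metric_space) \<Rightarrow> real \<Rightarrow> real" where
  "arc_length \<gamma> t = Sup (polygon_lengths \<gamma> 0 t)"

text \<open>\<open>\<integral>\<^sub>\<gamma> h(\<xi>) |d\<xi>|\<close> is the Lebesgue--Stieltjes integral of \<open>h \<circ> \<gamma>\<close> over \<open>[0,1]\<close> with
  respect to the arc-length function, which is extended to the whole line by constants.\<close>

definition arc_length_integral :: "('a::metric_space \<Rightarrow> real) \<Rightarrow> (real \<Rightarrow> 'a) \<Rightarrow> real" where
  "arc_length_integral h \<gamma> =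
     (LINT t:{0..1}|interval_measure (\<lambda>t. arc_length \<gamma> (min 1 (max 0 t))). h (\<gamma> t))"

definition rho :: "complex^'n \<Rightarrow> complex^'n \<Rightarrow> real" where
  "rho z w = Inf {arc_length_integral (\<lambda>\<xi>. 2 / (1 - (norm \<xi>)\<^sup>2)) \<gamma> | \<gamma>.
     rectifiable_path \<gamma> \<and> path_image \<gamma> \<subseteq> ball 0 1 \<and> pathstart \<gamma> = z \<and> pathfinish \<gamma> = w}"

definition koranyi :: "complex^'n \<Rightarrow> real \<Rightarrow> (complex^'n) set" where
  "koranyi \<tau> M = {z \<in> ball 0 1. cmod (1 - herm z \<tau>) < M * (1 - norm z)}"

section \<open>Local Sobolev spaces\<close>

text \<open>\<open>C_k k \<phi>\<close>: \<open>\<phi>\<close> is of class \<open>C\<^sup>k\<close> on the whole space.\<close>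

primrec C_k :: "nat \<Rightarrow> ('a::euclidean_space \<Rightarrow> real) \<Rightarrow> bool" where
  "C_k 0 \<phi> \<longleftrightarrow> continuous_on UNIV \<phi>"
| "C_k (Suc k) \<phi> \<longleftrightarrow>
     (\<forall>x. \<phi> differentiable (at x)) \<and> (\<forall>e\<in>Basis. C_k k (\<lambda>x. frechet_derivative \<phi> (at x) e))"

definition test_function_on :: "'a::euclidean_space set \<Rightarrow> ('a \<Rightarrow> real) \<Rightarrow> bool" where
  "test_function_on \<Omega> \<phi> \<longleftrightarrow>
     (\<forall>k. C_k k \<phi>) \<and> compact (closure {x. \<phi> x \<noteq> 0}) \<and> closure {x. \<phi> x \<noteq> 0} \<subseteq> \<Omega>"

definition weak_derivative_on ::
  "'a::euclidean_space set \<Rightarrow> ('a \<Rightarrow> 'b::euclidean_space) \<Rightarrow> ('a \<Rightarrow> 'a \<Rightarrow>\<^sub>L 'b) \<Rightarrow> bool" where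
  "weak_derivative_on \<Omega> f Df \<longleftrightarrow>
     (\<forall>\<phi> e. test_function_on \<Omega> \<phi> \<and> e \<in> Basis \<longrightarrow>
        (LINT x:\<Omega>|lebesgue. frechet_derivative \<phi> (at x) e *\<^sub>R f x) =
        - (LINT x:\<Omega>|lebesgue. \<phi> x *\<^sub>R blinfun_apply (Df x) e))"

definition Lp_loc :: "real \<Rightarrow> 'a::euclidean_space set \<Rightarrow> ('a \<Rightarrow> 'b::real_normed_vector) \<Rightarrow> bool" where
  "Lp_loc p \<Omega> f \<longleftrightarrow>
     (\<forall>C. compact C \<and> C \<subseteq> \<Omega> \<longrightarrow>
        set_borel_measurable lebesgue C f \<and> set_integrable lebesgue C (\<lambda>x. norm (f x) powr p))"

text \<open>\<open>W1p_loc p \<Omega> f Df\<close>: \<open>f \<in> W\<^sup>1\<^sup>,\<^sup>p\<^sub>l\<^sub>o\<^sub>c(\<Omega>)\<close> with weak derivative \<open>Df\<close>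
  (unique up to null sets).\<close>

definition W1p_loc ::
  "real \<Rightarrow> 'a::euclidean_space set \<Rightarrow> ('a \<Rightarrow> 'b::euclidean_space) \<Rightarrow> ('a \<Rightarrow> 'a \<Rightarrow>\<^sub>L 'b) \<Rightarrow> bool" where
  "W1p_loc p \<Omega> f Df \<longleftrightarrow> Lp_loc p \<Omega> f \<and> Lp_loc p \<Omega> Df \<and> weak_derivative_on \<Omega> f Df"

section \<open>Quasiconformal self-maps of the ball\<close>

text \<open>The identification of \<open>\<complex>\<^sup>n\<close> with \<open>\<real>\<^sup>2\<^sup>n\<close>, the coordinates of the latter being indexed by \<open>'n + 'n\<close>.\<close>

definition real_coords :: "complex^'n \<Rightarrow> real^('n + 'n)" where
  "real_coords z = (\<chi> i. case i of Inl j \<Rightarrow> Re (z $ j) | Inr j \<Rightarrow> Im (z $ j))"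

definition complex_coords :: "real^('n + 'n) \<Rightarrow> complex^'n" where
  "complex_coords x = (\<chi> j. Complex (x $ Inl j) (x $ Inr j))"

definition real_det :: "((complex^'n) \<Rightarrow>\<^sub>L (complex^'n)) \<Rightarrow> real" where
  "real_det A = det (matrix (real_coords \<circ> blinfun_apply A \<circ> complex_coords))"

text \<open>For an injective continuous map \<open>f\<close> on an open set \<open>S\<close>, preservation of orientation means
  that the local degree is 1, i.e. that for every closed ball \<open>cball z r\<close> in \<open>S\<close> the self-map
  \<open>x \<mapsto> (f (z + r x) - f z) / |f (z + r x) - f z|\<close> of the unit sphere has degree 1.  As
  \<open>Brouwer_degree2\<close> lives on sequences of reals, the sphere is transported along an enumeration
  \<open>e\<close> of the standard basis; the same \<open>e\<close> is used on both sides, so the degree does not depend on it.\<close>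

definition sphere_map ::
  "('a::euclidean_space \<Rightarrow> 'a) \<Rightarrow> 'a \<Rightarrow> real \<Rightarrow> (nat \<Rightarrow> 'a) \<Rightarrow> (nat \<Rightarrow> real) \<Rightarrow> nat \<Rightarrow> real" where
  "sphere_map f z r e x i =
     (if i < DIM('a) then sgn (f (z + r *\<^sub>R (\<Sum>j<DIM('a). x j *\<^sub>R e j)) - f z) \<bullet> e i else 0)"

definition orientation_preserving_on ::
  "'a::euclidean_space set \<Rightarrow> ('a \<Rightarrow> 'a) \<Rightarrow> bool" where
  "orientation_preserving_on S f \<longleftrightarrow>
     (\<forall>z r e. 0 < r \<and> cball z r \<subseteq> S \<and> bij_betw e {..<DIM('a)} Basis \<longrightarrow>
        Brouwer_degree2 (DIM('a) - 1) (sphere_map f z r e) = 1)"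

text \<open>The norm of \<open>Df z\<close>, a member of the type \<open>_ \<Rightarrow>\<^sub>L _\<close> of bounded real-linear maps, is the operator norm.\<close>

definition quasiconformal_ball :: "real \<Rightarrow> (complex^'n \<Rightarrow> complex^'n) \<Rightarrow> bool" where
  "quasiconformal_ball K f \<longleftrightarrow>
     (\<exists>g. homeomorphism (ball 0 1) (ball 0 1) f g) \<and>
     orientation_preserving_on (ball 0 1) f \<and>
     (\<exists>Df. W1p_loc (2 * real CARD('n)) (ball 0 1) f Df \<and>
        (AE z in lebesgue. z \<in> ball 0 1 \<longrightarrow>
           norm (Df z) ^ (2 * CARD('n)) \<le> K * real_det (Df z)))"

end

theory Submission
  imports Defs
begin

text \<open>The logarithm of the Euclidean distance to the boundary is compared with two other quantities.

  On the hyperbolic side, the distance from \<open>z\<close> to a fixed point \<open>w\<close> is \<open>- ln (1 - norm z)\<close> up to a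
  bounded term.  No curve from \<open>z\<close> to \<open>w\<close> is shorter than the difference of the hyperbolic distances
  of its end points to the origin (\<open>hyperbolic_length_ge\<close>), and the curve through the origin made of
  two radii attains at most their sum (\<open>broken_radius_path\<close>); hence \<open>rho_log_boundary_distance\<close>.
  Both bounds integrate a mean value inequality for the function \<open>2 artanh\<close> with respect to arc length
  (\<open>stieltjes_integral_ge\<close>).  As length is defined by inscribed polygons and the integral is a
  Lebesgue--Stieltjes integral, this requires that arc length is additive (\<open>arc_length_add\<close>) and
  right-continuous in the parameter (\<open>arc_length_right_continuous\<close>).

  On the dynamical side, the orbit eventually stays in one Koranyi region, where \<open>1 - norm z\<close> and
  \<open>cmod (1 - herm z \<tau>)\<close> agree up to a constant factor (\<open>koranyi_boundary_distance\<close>).  Along the orbit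
  the latter quantity is multiplied at each step by \<open>\<alpha> * (1 + h)\<close>.  It therefore decays geometrically,
  which makes the logarithms of the correction factors summable; so its logarithm is \<open>k * ln \<alpha>\<close> up to
  a bounded term (\<open>geometric_decay_log\<close>).  Adding the two comparisons gives the asymptotics.\<close>

section \<open>Additivity and right-continuity of arc length\<close>

lemma polygon_lengthsI:
  "mono t \<Longrightarrow> (\<And>i. t i \<in> {a..b}) \<Longrightarrow>
     (\<Sum>i<m. dist (\<gamma> (t i)) (\<gamma> (t (Suc i)))) \<in> polygon_lengths \<gamma> a b"
  unfolding polygon_lengths_def by blast

lemma polygon_lengthsE:
  assumes "x \<in> polygon_lengths \<gamma> a b"
  obtains m t where "mono t" "\<And>i. t i \<in> {a..b}"
    "x = (\<Sum>i<(m::nat). dist (\<gamma> (t i)) (\<gamma> (t (Suc i))))"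
  using assms unfolding polygon_lengths_def by blast

lemma polygon_lengths_mono:
  assumes "a' \<le> a" "b \<le> b'"
  shows "polygon_lengths \<gamma> a b \<subseteq> polygon_lengths \<gamma> a' b'"
proof -
  have "{a..b} \<subseteq> {a'..b'}" using assms by auto
  then show ?thesis unfolding polygon_lengths_def by fast
qed

lemma bdd_above_polygon_lengths:
  assumes "bdd_above (polygon_lengths \<gamma> 0 1)" "0 \<le> a" "b \<le> 1"
  shows "bdd_above (polygon_lengths \<gamma> a b)"
  using bdd_above_mono[OF assms(1) polygon_lengths_mono[OF assms(2,3)]] .

lemma zero_in_polygon_lengths: "a \<le> b \<Longrightarrow> 0 \<in> polygon_lengths \<gamma> a b"
  using polygon_lengthsI[of "\<lambda>_. a" a b \<gamma> 0] by (simp add: mono_def)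

lemma dist_in_polygon_lengths:
  assumes "a \<le> b" shows "dist (\<gamma> a) (\<gamma> b) \<in> polygon_lengths \<gamma> a b"
  using polygon_lengthsI[of "\<lambda>i. if i = 0 then a else b" a b \<gamma> 1] assms
  by (auto simp: mono_def)

lemma sum_split:
  fixes g :: "nat \<Rightarrow> 'a::comm_monoid_add"
  shows "(\<Sum>i<n+k. g i) = (\<Sum>i<n. g i) + (\<Sum>i<k. g (n + i))"
  by (induction k) (simp_all add: ac_simps)

lemma polygon_lengths_concat:
  assumes x: "x \<in> polygon_lengths \<gamma> a b" and y: "y \<in> polygon_lengths \<gamma> b c" 
  shows "\<exists>z\<in>polygon_lengths \<gamma> a c. x + y \<le> z"
proof -
  obtain m t where t: "mono t" "\<And>i. t i \<in> {a..b}"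
    "x = (\<Sum>i<(m::nat). dist (\<gamma> (t i)) (\<gamma> (t (Suc i))))" using x by (rule polygon_lengthsE) blast
  obtain k u where u: "mono u" "\<And>i. u i \<in> {b..c}"
    "y = (\<Sum>i<(k::nat). dist (\<gamma> (u i)) (\<gamma> (u (Suc i))))" using y by (rule polygon_lengthsE) blast
  \<comment> \<open>The edge from \<open>t m\<close> to \<open>u 0\<close>, with index \<open>m\<close>, joins the two polygons; it is why the claim is an
    inequality and why the second polygon starts at \<open>Suc m\<close>.\<close>
  define v where "v i = (if i \<le> m then t i else u (i - Suc m))" for i
  let ?d = "\<lambda>i. dist (\<gamma> (v i)) (\<gamma> (v (Suc i)))"
  have le: "t i \<le> u j" for i j using t(2)[of i] u(2)[of j] by auto
  have "mono v"
    unfolding mono_def v_def using t(1) u(1) le by (auto simp: mono_def)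
  moreover have "v i \<in> {a..c}" for i
    using t(2)[of i] u(2)[of "i - Suc m"] t(2)[of 0] u(2)[of 0] by (auto simp: v_def)
  ultimately have "(\<Sum>i<Suc m + k. ?d i) \<in> polygon_lengths \<gamma> a c"
    by (rule polygon_lengthsI)
  moreover have "(\<Sum>i<Suc m + k. ?d i) = (\<Sum>i<Suc m. ?d i) + (\<Sum>i<k. ?d (Suc m + i))"
    by (rule sum_split)
  moreover have "(\<Sum>i<Suc m. ?d i) = x + ?d m" by (simp add: t v_def)
  moreover have "(\<Sum>i<k. ?d (Suc m + i)) = y" by (simp add: u v_def)
  ultimately have "x + ?d m + y \<in> polygon_lengths \<gamma> a c" by simp
  then show ?thesis by (rule bexI[rotated]) simp
qed

text \<open>Clamping all vertices of a polygon to \<open>{a..b}\<close> and to \<open>{b..c}\<close> inserts \<open>b\<close> as a vertex without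
  locating the edge that crosses it: every other edge degenerates in one of the two clamped polygons,
  and the crossing edge is handled by the triangle inequality.\<close>
lemma polygon_lengths_split:
  assumes "x \<in> polygon_lengths \<gamma> a c" "a \<le> b" "b \<le> c"
  shows "\<exists>y\<in>polygon_lengths \<gamma> a b. \<exists>z\<in>polygon_lengths \<gamma> b c. x \<le> y + z"
proof -
  obtain m t where t: "mono t" "\<And>i. t i \<in> {a..c}"
    "x = (\<Sum>i<(m::nat). dist (\<gamma> (t i)) (\<gamma> (t (Suc i))))" 
    using assms(1) by (rule polygon_lengthsE) blast
  let ?l = "\<lambda>i. dist (\<gamma> (min b (t i))) (\<gamma> (min b (t (Suc i))))"
  let ?r = "\<lambda>i. dist (\<gamma> (max b (t i))) (\<gamma> (max b (t (Suc i))))"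
  have "(\<Sum>i<m. ?l i) \<in> polygon_lengths \<gamma> a b"
    using t assms by (intro polygon_lengthsI) (auto simp: mono_def min.coboundedI2)
  moreover have "(\<Sum>i<m. ?r i) \<in> polygon_lengths \<gamma> b c"
    using t assms by (intro polygon_lengthsI) (auto simp: mono_def max.coboundedI2)
  moreover have "dist (\<gamma> (t i)) (\<gamma> (t (Suc i))) \<le> ?l i + ?r i" for i
  proof -
    have "t i \<le> t (Suc i)" using t(1) by (simp add: mono_def)
    then consider "t (Suc i) \<le> b" | "b \<le> t i" | "t i \<le> b" "b \<le> t (Suc i)" by linarith
    then show ?thesis
      by cases (use \<open>t i \<le> t (Suc i)\<close> in \<open>auto simp: min_def max_def dist_triangle\<close>)
  qed
  then have "x \<le> (\<Sum>i<m. ?l i) + (\<Sum>i<m. ?r i)"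
    unfolding t(3) by (simp add: sum.distrib[symmetric] sum_mono)
  ultimately show ?thesis by blast
qed

lemma arc_length_add:
  assumes bdd: "bdd_above (polygon_lengths \<gamma> 0 1)" and "0 \<le> a" "a \<le> b" "b \<le> 1"
  shows "arc_length \<gamma> b = arc_length \<gamma> a + Sup (polygon_lengths \<gamma> a b)"
proof -
  have ne: "polygon_lengths \<gamma> x y \<noteq> {}" if "x \<le> y" for x y
    using zero_in_polygon_lengths[OF that] by blast
  have bd: "bdd_above (polygon_lengths \<gamma> x y)" if "0 \<le> x" "y \<le> 1" for x y
    using bdd_above_polygon_lengths[OF bdd] that by simp
  show ?thesis unfolding arc_length_def
  proof (rule antisym)
    show "Sup (polygon_lengths \<gamma> 0 b) \<le> Sup (polygon_lengths \<gamma> 0 a) + Sup (polygon_lengths \<gamma> a b)"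
    proof (rule cSup_least)
      fix x assume "x \<in> polygon_lengths \<gamma> 0 b"
      then obtain y z where "y \<in> polygon_lengths \<gamma> 0 a" "z \<in> polygon_lengths \<gamma> a b" "x \<le> y + z"
        using polygon_lengths_split assms by blast
      moreover from this have "y \<le> Sup (polygon_lengths \<gamma> 0 a)" "z \<le> Sup (polygon_lengths \<gamma> a b)"
        using assms by (auto intro!: cSup_upper bd)
      ultimately show "x \<le> Sup (polygon_lengths \<gamma> 0 a) + Sup (polygon_lengths \<gamma> a b)" by linarith
    qed (rule ne, use assms in simp)
    have *: "y + z \<le> Sup (polygon_lengths \<gamma> 0 b)"
      if y: "y \<in> polygon_lengths \<gamma> 0 a" and z: "z \<in> polygon_lengths \<gamma> a b" for y z
    proof -
      obtain x where "x \<in> polygon_lengths \<gamma> 0 b" "y + z \<le> x"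
        using polygon_lengths_concat[OF y z] by blast
      then show ?thesis using cSup_upper[OF _ bd[of 0 b]] assms by fastforce
    qed
    have "Sup (polygon_lengths \<gamma> a b) \<le> Sup (polygon_lengths \<gamma> 0 b) - y"
      if "y \<in> polygon_lengths \<gamma> 0 a" for y
    proof (rule cSup_least)
      show "polygon_lengths \<gamma> a b \<noteq> {}" by (rule ne) (use assms in simp)
      show "z \<le> Sup (polygon_lengths \<gamma> 0 b) - y" if "z \<in> polygon_lengths \<gamma> a b" for z
        using *[OF \<open>y \<in> _\<close> that] by linarith
    qed
    then have "Sup (polygon_lengths \<gamma> 0 a) \<le> Sup (polygon_lengths \<gamma> 0 b) - Sup (polygon_lengths \<gamma> a b)"
      using assms by (intro cSup_least ne) (auto simp: le_diff_eq add.commute)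
    then show "Sup (polygon_lengths \<gamma> 0 a) + Sup (polygon_lengths \<gamma> a b) \<le> Sup (polygon_lengths \<gamma> 0 b)"
      by simp
  qed
qed

lemma dist_le_arc_length_diff:
  assumes "bdd_above (polygon_lengths \<gamma> 0 1)" and "0 \<le> a" "a \<le> b" "b \<le> 1"
  shows "dist (\<gamma> a) (\<gamma> b) \<le> arc_length \<gamma> b - arc_length \<gamma> a"
proof -
  have "bdd_above (polygon_lengths \<gamma> a b)"
    using bdd_above_polygon_lengths[OF assms(1)] assms by simp
  then have "dist (\<gamma> a) (\<gamma> b) \<le> Sup (polygon_lengths \<gamma> a b)"
    by (intro cSup_upper dist_in_polygon_lengths assms)
  then show ?thesis using arc_length_add[OF assms] by simp
qed

text \<open>The increments of \<open>v\<close> along the vertices telescope.\<close>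
lemma polygon_length_le:
  assumes v: "\<And>s t. a \<le> s \<Longrightarrow> s \<le> t \<Longrightarrow> t \<le> b \<Longrightarrow> dist (\<gamma> s) (\<gamma> t) \<le> v t - v s"
    and x: "x \<in> polygon_lengths \<gamma> a b"
  shows "x \<le> v b - v a"
proof -
  obtain m t where t: "mono t" "\<And>i. t i \<in> {a..b}"
    "x = (\<Sum>i<(m::nat). dist (\<gamma> (t i)) (\<gamma> (t (Suc i))))" 
    using x by (rule polygon_lengthsE) blast
  have "x \<le> (\<Sum>i<m. v (t (Suc i)) - v (t i))"
    unfolding t(3) using t(1,2) by (intro sum_mono v) (auto simp: mono_def)
  also have "\<dots> = v (t m) - v (t 0)" by (rule sum_lessThan_telescope)
  also have "\<dots> \<le> v b - v a"
    using order_trans[OF zero_le_dist v[of a "t 0"]] order_trans[OF zero_le_dist v[of "t m" b]]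
      t(2)[of 0] t(2)[of m] by auto
  finally show ?thesis .
qed

text \<open>The distribution function of the measure that defines \<^const>\<open>arc_length_integral\<close>.\<close>
definition arc_length_ext :: "(real \<Rightarrow> 'a::metric_space) \<Rightarrow> real \<Rightarrow> real" where
  "arc_length_ext \<gamma> t = arc_length \<gamma> (min 1 (max 0 t))"

lemma arc_length_ext_mono:
  assumes "bdd_above (polygon_lengths \<gamma> 0 1)" "x \<le> y"
  shows "arc_length_ext \<gamma> x \<le> arc_length_ext \<gamma> y"
  using order_trans[OF zero_le_dist dist_le_arc_length_diff[OF assms(1), of "min 1 (max 0 x)" "min 1 (max 0 y)"]]
    assms(2) unfolding arc_length_ext_def by auto

text \<open>\<^const>\<open>interval_measure\<close> has the expected values on intervals only for right-continuous functions.
  By additivity the claim is that the length over \<open>{a..1}\<close> is hardly larger than that over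
  \<open>{a + d..1}\<close>.  Truncating a fixed polygon from below at \<open>s\<close> gives a length \<open>P s\<close> that is continuous
  in \<open>s\<close> and bounded by the length over \<open>{s..1}\<close>; a polygon that is almost optimal at \<open>s = a\<close> is
  therefore almost as long at \<open>s = a + d\<close>.\<close>
lemma arc_length_right_continuous:
  assumes \<gamma>: "path \<gamma>" and bdd: "bdd_above (polygon_lengths \<gamma> 0 1)"
    and a: "0 \<le> a" "a < 1" and e: "0 < e"
  shows "\<exists>d>0. a + d \<le> 1 \<and> arc_length \<gamma> (a + d) - arc_length \<gamma> a < e"
proof -
  have ne: "polygon_lengths \<gamma> a 1 \<noteq> {}" using zero_in_polygon_lengths[of a 1] a by auto
  have bd: "bdd_above (polygon_lengths \<gamma> x 1)" if "0 \<le> x" for x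
    using bdd_above_polygon_lengths[OF bdd] that by simp
  obtain x where x: "x \<in> polygon_lengths \<gamma> a 1" "Sup (polygon_lengths \<gamma> a 1) - e < x"
    using less_cSup_iff[OF ne bd, of "Sup (polygon_lengths \<gamma> a 1) - e"] a e by auto
  obtain m t where t: "mono t" "\<And>i. t i \<in> {a..1}"
    "x = (\<Sum>i<(m::nat). dist (\<gamma> (t i)) (\<gamma> (t (Suc i))))" 
    using x(1) by (rule polygon_lengthsE) blast
  define P where "P s = (\<Sum>i<m. dist (\<gamma> (max s (t i))) (\<gamma> (max s (t (Suc i)))))" for s
  have max_t: "max a (t i) = t i" for i using t(2)[of i] by auto
  have Pa: "P a = x" unfolding P_def t(3) max_t ..
  have g: "continuous_on {a..1} (\<lambda>s. \<gamma> (max s (t i)))" for i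
  proof (rule continuous_on_compose2[of "{0..1}" \<gamma>])
    show "continuous_on {0..1} \<gamma>" using \<gamma> by (simp add: path_def)
    show "continuous_on {a..1} (\<lambda>s. max s (t i))" by (intro continuous_intros)
    show "(\<lambda>s. max s (t i)) ` {a..1} \<subseteq> {0..1}" using t(2)[of i] a by (auto simp: max_def)
  qed
  have cont: "continuous_on {a..1} P" unfolding P_def by (intro continuous_on_sum continuous_on_dist g)
  have "0 < x - (Sup (polygon_lengths \<gamma> a 1) - e)" "a \<in> {a..1}" using x(2) a by auto
  with cont have "\<exists>d>0. \<forall>s\<in>{a..1}. dist s a < d \<longrightarrow> dist (P s) (P a) < x - (Sup (polygon_lengths \<gamma> a 1) - e)"
    unfolding continuous_on_iff by blast
  then obtain d where d: "d > 0"
    "\<And>s. s\<in>{a..1} \<Longrightarrow> dist s a < d \<Longrightarrow> dist (P s) (P a) < x - (Sup (polygon_lengths \<gamma> a 1) - e)" by blast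
  define r where "r = min (d/2) (1 - a)"
  have r: "0 < r" "r < d" "a + r \<le> 1" using d a by (auto simp: r_def)
  have "P (a + r) > Sup (polygon_lengths \<gamma> a 1) - e"
    using d(2)[of "a + r"] r a Pa by (auto simp: dist_real_def)
  moreover have "P (a + r) \<in> polygon_lengths \<gamma> (a + r) 1"
    unfolding P_def using t r by (intro polygon_lengthsI) (auto simp: mono_def max.coboundedI2)
  then have "P (a + r) \<le> Sup (polygon_lengths \<gamma> (a + r) 1)"
    using a r by (intro cSup_upper bd) auto
  ultimately have "Sup (polygon_lengths \<gamma> a 1) - e < Sup (polygon_lengths \<gamma> (a + r) 1)" by linarith
  then have "arc_length \<gamma> (a + r) - arc_length \<gamma> a < e"
    using arc_length_add[OF bdd, of a 1] arc_length_add[OF bdd, of "a + r" 1] a r by auto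
  then show ?thesis using r by blast
qed

lemma arc_length_ext_right_continuous:
  assumes \<gamma>: "path \<gamma>" and bdd: "bdd_above (polygon_lengths \<gamma> 0 1)"
  shows "continuous (at_right a) (arc_length_ext \<gamma>)"
proof (subst continuous_at_right_real_increasing)
  show "arc_length_ext \<gamma> x \<le> arc_length_ext \<gamma> y" if "x \<le> y" for x y
    using arc_length_ext_mono[OF bdd that] .
  show "\<forall>e>0. \<exists>d>0. arc_length_ext \<gamma> (a + d) - arc_length_ext \<gamma> a < e"
  proof (intro allI impI)
    fix e :: real assume e: "e > 0"
    consider "a < 0" | "1 \<le> a" | "0 \<le> a" "a < 1" by linarith
    then show "\<exists>d>0. arc_length_ext \<gamma> (a + d) - arc_length_ext \<gamma> a < e"
    proof cases
      case 1 then show ?thesis using e by (intro exI[of _ "- a"]) (auto simp: arc_length_ext_def)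
    next
      case 2 then show ?thesis using e by (intro exI[of _ 1]) (auto simp: arc_length_ext_def)
    next
      case 3
      then obtain d where "d>0" "a + d \<le> 1" "arc_length \<gamma> (a + d) - arc_length \<gamma> a < e"
        using arc_length_right_continuous[OF \<gamma> bdd _ _ e] by blast
      then show ?thesis using 3 by (intro exI[of _ d]) (auto simp: arc_length_ext_def)
    qed
  qed
qed

section \<open>Stieltjes integrals and mean values\<close>

text \<open>A mean value inequality for \<open>G\<close> against \<open>dF\<close> on every subinterval gives an integral inequality:
  over a fine partition \<open>k\<close> varies by less than \<open>e\<close> on each piece, so \<open>k c * (F b - F a)\<close> exceeds the
  integral of \<open>k\<close> over \<open>{a<..b}\<close> by at most \<open>e * (F b - F a)\<close>, and the increments of \<open>G\<close> telescope.
  \<open>F\<close> is constant to the left of \<open>0\<close>, so that the point \<open>0\<close>, which the half-open pieces miss, carries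
  no mass.  As \<open>k\<close> may be negative, applying the lemma to \<open>-k\<close> and \<open>-G\<close> bounds integrals from above.\<close>
lemma stieltjes_integral_ge:
  fixes F G k :: "real \<Rightarrow> real"
  assumes mono: "\<And>x y. x \<le> y \<Longrightarrow> F x \<le> F y"
    and right: "\<And>x. continuous (at_right x) F"
    and const: "\<And>x. x \<le> 0 \<Longrightarrow> F x = F 0"
    and k: "continuous_on {0..1} k"
    and G: "\<And>a b. 0 \<le> a \<Longrightarrow> a \<le> b \<Longrightarrow> b \<le> 1 \<Longrightarrow> \<exists>c\<in>{a..b}. G b - G a \<le> k c * (F b - F a)"
  shows "G 1 - G 0 \<le> (LINT t:{0..1}|interval_measure F. k t)"
proof -
  define \<mu> where "\<mu> = interval_measure F"
  have sets: "sets \<mu> = sets borel" by (simp add: \<mu>_def)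
  have em: "emeasure \<mu> {a<..b} = ennreal (F b - F a)" if "a \<le> b" for a b
    unfolding \<mu>_def by (rule emeasure_interval_measure_Ioc[OF that mono right])
  have me: "measure \<mu> {a<..b} = F b - F a" if "a \<le> b" for a b
    using em[OF that] mono[OF that] by (simp add: measure_def)
  obtain B where B: "\<And>t. t \<in> {0..1} \<Longrightarrow> norm (k t) \<le> B"
    using compact_imp_bounded[OF compact_continuous_image[OF k compact_Icc]]
    by (metis bounded_iff imageI)
  have fin: "emeasure \<mu> A < \<infinity>" if "A \<subseteq> {0..1}" "A \<in> sets borel" for A
  proof -
    have "emeasure \<mu> A \<le> emeasure \<mu> {-1<..1}" using that by (intro emeasure_mono) (auto simp: sets)
    then show ?thesis by (simp add: em le_less_trans)
  qed
  have int: "set_integrable \<mu> A k" if "A \<subseteq> {0..1}" "A \<in> sets borel" for A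
  proof -
    have "(\<lambda>x. indicator {0..1} x *\<^sub>R k x) \<in> borel_measurable borel"
      by (rule borel_measurable_continuous_on_indicator[OF _ k]) simp
    then have "(\<lambda>x. indicator {0..1} x *\<^sub>R k x) \<in> borel_measurable \<mu>"
      using measurable_cong_sets[OF sets refl] by blast
    then have "integrable \<mu> (\<lambda>x. indicator A x *\<^sub>R (indicator {0..1} x *\<^sub>R k x))"
    proof (intro integrableI_bounded_set_indicator[where B=B])
      show "AE x in \<mu>. x \<in> A \<longrightarrow> norm (indicator {0..1} x *\<^sub>R k x) \<le> B"
        using B that by (intro AE_I2) auto
    qed (use that fin[OF that] in \<open>auto simp: sets\<close>)
    also have "(\<lambda>x. indicator A x *\<^sub>R (indicator {0..1} x *\<^sub>R k x)) = (\<lambda>x. indicator A x *\<^sub>R k x)"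
      using that(1) by (intro ext) (auto simp: indicator_def subset_iff)
    finally show ?thesis unfolding set_integrable_def .
  qed
  have approx: "G 1 - G 0 \<le> (LINT t:{0<..1}|\<mu>. k t) + e * (F 1 - F 0)" if e: "e > 0" for e
  proof -
    have "uniformly_continuous_on {0..1} k" by (rule compact_uniformly_continuous[OF k]) simp
    then obtain d where d: "d > 0" "\<And>x y. x \<in> {0..1} \<Longrightarrow> y \<in> {0..1} \<Longrightarrow> dist y x < d \<Longrightarrow> dist (k y) (k x) < e"
      unfolding uniformly_continuous_on_def using e by metis
    obtain n :: nat where n: "n > 0" "1 / real n < d"
      using real_arch_inverse[of d] d(1) by (auto simp: inverse_eq_divide)
    have "G (real j / n) - G 0 \<le> (LINT t:{0<..real j / n}|\<mu>. k t) + e * (F (real j / n) - F 0)" if "j \<le> n" for j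
      using that
    proof (induction j)
      case 0 then show ?case by (simp add: set_lebesgue_integral_def)
    next
      case (Suc j)
      define a b where "a = real j / n" and "b = real (Suc j) / n"
      have ab: "0 \<le> a" "a \<le> b" "b \<le> 1" "b - a < d"
        using Suc.prems n by (auto simp: a_def b_def divide_simps)
      obtain c where c: "c \<in> {a..b}" "G b - G a \<le> k c * (F b - F a)" using G ab by blast
      have m: "measure \<mu> {a<..b} = F b - F a" "emeasure \<mu> {a<..b} < \<infinity>"
        using me em ab by auto
      have ci: "set_integrable \<mu> {a<..b} (\<lambda>t. k c)"
        using m by (simp add: set_integrable_def sets)
      have "k c * (F b - F a) = (LINT t:{a<..b}|\<mu>. k c)"
        using m by (simp add: set_lebesgue_integral_def sets)
      also have "\<dots> \<le> (LINT t:{a<..b}|\<mu>. k t + e)"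
      proof (rule set_integral_mono)
        show "set_integrable \<mu> {a<..b} (\<lambda>t. k t + e)"
          using ab m by (intro set_integral_add int) (auto simp: set_integrable_def sets)
        fix t assume t: "t \<in> {a<..b}"
        then have "\<bar>t - c\<bar> < d" "c \<in> {0..1}" "t \<in> {0..1}" using c(1) ab by (auto simp: abs_if)
        then have "\<bar>k t - k c\<bar> < e" using d(2)[of c t] by (simp add: dist_real_def)
        then show "k c \<le> k t + e" by linarith
      qed (rule ci)
      also have "\<dots> = (LINT t:{a<..b}|\<mu>. k t) + (LINT t:{a<..b}|\<mu>. e)"
        using ab m by (intro set_integral_add int) (auto simp: set_integrable_def sets)
      also have "(LINT t:{a<..b}|\<mu>. e) = e * (F b - F a)"
        using m by (simp add: set_lebesgue_integral_def sets)
      finally have 1: "G b - G a \<le> (LINT t:{a<..b}|\<mu>. k t) + e * (F b - F a)" using c by linarith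
      have "(LINT t:{0<..a} \<union> {a<..b}|\<mu>. k t) = (LINT t:{0<..a}|\<mu>. k t) + (LINT t:{a<..b}|\<mu>. k t)"
        using ab by (intro set_integral_Un int) auto
      moreover have "{0<..a} \<union> {a<..b} = {0<..b}" using ab by auto
      moreover have "G a - G 0 \<le> (LINT t:{0<..a}|\<mu>. k t) + e * (F a - F 0)"
        using Suc unfolding a_def by simp
      ultimately have "G b - G 0 \<le> (LINT t:{0<..b}|\<mu>. k t) + e * (F b - F 0)"
        using 1 by (simp add: algebra_simps)
      then show ?case unfolding b_def .
    qed
    from this[of n] n show ?thesis by simp
  qed
  \<comment> \<open>Dividing by \<open>D + 1\<close> rather than \<open>D\<close> covers the case that \<open>F\<close> is constant.\<close>
  have "G 1 - G 0 \<le> (LINT t:{0<..1}|\<mu>. k t)"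
  proof (rule field_le_epsilon)
    fix e :: real assume e: "e > 0"
    define D where "D = F 1 - F 0"
    have D: "D \<ge> 0" using mono[of 0 1] by (simp add: D_def)
    have "G 1 - G 0 \<le> (LINT t:{0<..1}|\<mu>. k t) + e / (D + 1) * D"
      unfolding D_def[symmetric] using approx[of "e / (D + 1)"] e D by (simp add: D_def)
    moreover have "e / (D + 1) * D \<le> e" using e D by (simp add: divide_simps)
    ultimately show "G 1 - G 0 \<le> (LINT t:{0<..1}|\<mu>. k t) + e" by linarith
  qed
  moreover have "(LINT t:{0<..1}|\<mu>. k t) = (LINT t:{0..1}|\<mu>. k t)"
  proof (rule set_integral_cong_set)
    have "{-1<..0} \<in> null_sets \<mu>"
      using em[of "-1" 0] const[of "-1"] by (auto simp: null_sets_def sets)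
    from AE_not_in[OF this] show "AE x in \<mu>. x \<in> {0..1} \<longleftrightarrow> x \<in> {0<..1}"
      by eventually_elim auto
  qed (use int[of "{0..1}"] int[of "{0<..1}"] in \<open>auto simp: greaterThanAtMost_subseteq_atLeastAtMost_iff set_borel_measurable_def set_integrable_def\<close>)
  ultimately show ?thesis unfolding \<mu>_def by simp
qed

section \<open>Hyperbolic distance and Euclidean distance to the boundary\<close>

text \<open>This is \<open>2 artanh x\<close>: for \<open>0 \<le> x\<close> the hyperbolic distance from the origin to a point of norm \<open>x\<close>,
  extended oddly to negative \<open>x\<close> so that it is a signed coordinate along a diameter.\<close>
definition radial_dist :: "real \<Rightarrow> real" where
  "radial_dist x = ln ((1 + x) / (1 - x))"

lemma radial_dist_deriv:
  assumes "\<bar>x\<bar> < 1"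
  shows "(radial_dist has_real_derivative 2 / (1 - x\<^sup>2)) (at x)"
proof -
  have "((\<lambda>x. ln (1 + x) - ln (1 - x)) has_real_derivative 1 / (1 + x) + 1 / (1 - x)) (at x)"
    using assms by (auto intro!: derivative_eq_intros simp: divide_simps)
  moreover have "1 / (1 + x) + 1 / (1 - x) = 2 / (1 - x\<^sup>2)"
  proof -
    have "1 - x\<^sup>2 = (1 + x) * (1 - x)" by (simp add: power2_eq_square algebra_simps)
    moreover have "1 + x \<noteq> 0" "1 - x \<noteq> 0" using assms by auto
    ultimately show ?thesis by (simp add: divide_simps)
  qed
  moreover have "eventually (\<lambda>y. radial_dist y = ln (1 + y) - ln (1 - y)) (nhds x)"
  proof (rule eventually_mono)
    show "\<forall>\<^sub>F y in nhds x. y \<in> {-1<..<1}"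
      using assms by (intro eventually_nhds_in_open) auto
  qed (auto simp: radial_dist_def ln_div)
  ultimately show ?thesis using DERIV_cong_ev by fastforce
qed

lemma radial_dist_uminus: "\<bar>x\<bar> < 1 \<Longrightarrow> radial_dist (- x) = - radial_dist x"
  by (simp add: radial_dist_def ln_div)

lemma radial_dist_mvt:
  assumes "\<bar>a\<bar> < 1" "\<bar>b\<bar> < 1" "a \<le> b"
  shows "\<exists>x\<in>{a..b}. radial_dist b - radial_dist a = 2 / (1 - x\<^sup>2) * (b - a)"
proof (cases "a = b")
  case True then show ?thesis by auto
next
  case False
  then have "a < b" using assms by simp
  have "(radial_dist has_real_derivative 2 / (1 - x\<^sup>2)) (at x)" if "a \<le> x" "x \<le> b" for x
    using that assms by (intro radial_dist_deriv) auto
  from MVT2[OF \<open>a < b\<close> this]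
  obtain x where "a < x" "x < b" "radial_dist b - radial_dist a = (b - a) * (2 / (1 - x\<^sup>2))"
    by blast
  then show ?thesis by (intro bexI[of _ x]) (auto simp: algebra_simps)
qed

lemma ball_density_continuous:
  fixes \<gamma> :: "real \<Rightarrow> 'a::real_normed_vector"
  assumes "path \<gamma>" "path_image \<gamma> \<subseteq> ball 0 1"
  shows "continuous_on {0..1} (\<lambda>t. 2 / (1 - (norm (\<gamma> t))\<^sup>2))"
proof -
  have "(norm (\<gamma> t))\<^sup>2 < 1" if "t \<in> {0..1}" for t
    using assms(2) that by (auto simp: path_image_def image_subset_iff power_less_one_iff)
  then have "1 - (norm (\<gamma> t))\<^sup>2 \<noteq> 0" if "t \<in> {0..1}" for t using that by fastforce
  then show ?thesis using assms(1) unfolding path_def by (intro continuous_intros) auto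
qed

lemma arc_length_ext_eq: "t \<in> {0..1} \<Longrightarrow> arc_length_ext \<gamma> t = arc_length \<gamma> t"
  by (simp add: arc_length_ext_def)

lemma arc_length_integral_ge:
  fixes \<gamma> :: "real \<Rightarrow> 'a::metric_space"
  assumes "rectifiable_path \<gamma>" and k: "continuous_on {0..1} (\<lambda>t. h (\<gamma> t))"
    and G: "\<And>a b. 0 \<le> a \<Longrightarrow> a \<le> b \<Longrightarrow> b \<le> 1 \<Longrightarrow>
              \<exists>c\<in>{a..b}. G b - G a \<le> h (\<gamma> c) * (arc_length \<gamma> b - arc_length \<gamma> a)"
  shows "G 1 - G 0 \<le> arc_length_integral h \<gamma>"
proof -
  have \<gamma>: "path \<gamma>" "bdd_above (polygon_lengths \<gamma> 0 1)"
    using assms by (auto simp: rectifiable_path_def)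
  have "G 1 - G 0 \<le> (LINT t:{0..1}|interval_measure (arc_length_ext \<gamma>). h (\<gamma> t))"
    by (rule stieltjes_integral_ge)
       (use arc_length_ext_mono[OF \<gamma>(2)] arc_length_ext_right_continuous[OF \<gamma>] k G
         in \<open>auto simp: arc_length_ext_eq\<close>, simp_all add: arc_length_ext_def)
  then show ?thesis by (simp add: arc_length_integral_def arc_length_ext_def[abs_def])
qed

text \<open>With this identity, \<open>arc_length_integral_ge\<close> also yields upper bounds.\<close>
lemma arc_length_integral_uminus:
  "arc_length_integral (\<lambda>x. - h x) \<gamma> = - arc_length_integral h \<gamma>"
  by (simp add: arc_length_integral_def set_lebesgue_integral_def)

text \<open>The distance to the origin cannot change faster than hyperbolic length is spent: over \<open>{a..b}\<close> the
  norm decreases by at most the arc length, and if it does decrease, the mean value \<open>x\<close> at which the derivative of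
  \<^const>\<open>radial_dist\<close> is taken is the norm of a point \<open>\<gamma> c\<close> of the curve.\<close>
lemma hyperbolic_length_ge:
  fixes \<gamma> :: "real \<Rightarrow> 'a::real_normed_vector"
  assumes \<gamma>: "rectifiable_path \<gamma>" "path_image \<gamma> \<subseteq> ball 0 1"
  shows "radial_dist (norm (pathstart \<gamma>)) - radial_dist (norm (pathfinish \<gamma>))
    \<le> arc_length_integral (\<lambda>\<xi>. 2 / (1 - (norm \<xi>)\<^sup>2)) \<gamma>"
proof -
  have p: "path \<gamma>" "bdd_above (polygon_lengths \<gamma> 0 1)"
    using \<gamma> by (auto simp: rectifiable_path_def)
  have ball: "norm (\<gamma> t) < 1" if "t \<in> {0..1}" for t
    using \<gamma>(2) that by (auto simp: path_image_def image_subset_iff)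
  have "- radial_dist (norm (\<gamma> 1)) - - radial_dist (norm (\<gamma> 0))
      \<le> arc_length_integral (\<lambda>\<xi>. 2 / (1 - (norm \<xi>)\<^sup>2)) \<gamma>"
  proof (rule arc_length_integral_ge[OF \<gamma>(1) ball_density_continuous[OF p(1) \<gamma>(2)]])
    fix a b :: real assume ab: "0 \<le> a" "a \<le> b" "b \<le> 1"
    define L where "L = arc_length \<gamma> b - arc_length \<gamma> a"
    have L: "norm (\<gamma> a - \<gamma> b) \<le> L"
      using dist_le_arc_length_diff[OF p(2) ab] by (simp add: L_def dist_norm)
    then have L0: "L \<ge> 0" using norm_ge_zero order_trans by blast
    have n: "norm (\<gamma> a) < 1" "norm (\<gamma> b) < 1" using ball ab by auto
    show "\<exists>c\<in>{a..b}. - radial_dist (norm (\<gamma> b)) - - radial_dist (norm (\<gamma> a))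
        \<le> 2 / (1 - (norm (\<gamma> c))\<^sup>2) * (arc_length \<gamma> b - arc_length \<gamma> a)"
    proof (cases "norm (\<gamma> b) \<le> norm (\<gamma> a)")
      case True
      then obtain x where x: "x \<in> {norm (\<gamma> b)..norm (\<gamma> a)}"
        "radial_dist (norm (\<gamma> a)) - radial_dist (norm (\<gamma> b)) = 2 / (1 - x\<^sup>2) * (norm (\<gamma> a) - norm (\<gamma> b))"
        using radial_dist_mvt n by (metis abs_norm_cancel)
      have "continuous_on {a..b} (\<lambda>t. norm (\<gamma> t))"
        using p(1) ab unfolding path_def
        by (intro continuous_on_norm) (auto intro: continuous_on_subset)
      then obtain c where c: "c \<in> {a..b}" "norm (\<gamma> c) = x"
        using IVT2'[of "\<lambda>t. norm (\<gamma> t)" b x a] x(1) ab by auto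
      have "0 \<le> x" "x < 1" using c ball[of c] ab by auto
      then have "0 \<le> 2 / (1 - x\<^sup>2)" by (simp add: power_le_one)
      moreover have "norm (\<gamma> a) - norm (\<gamma> b) \<le> L" using L norm_triangle_ineq2 order_trans by blast
      ultimately have "2 / (1 - x\<^sup>2) * (norm (\<gamma> a) - norm (\<gamma> b)) \<le> 2 / (1 - x\<^sup>2) * L"
        by (rule mult_left_mono[rotated])
      then show ?thesis using x(2) c unfolding L_def by (intro bexI[of _ c]) auto
    next
      case False
      then obtain x where x: "x \<in> {norm (\<gamma> a)..norm (\<gamma> b)}"
        "radial_dist (norm (\<gamma> b)) - radial_dist (norm (\<gamma> a)) = 2 / (1 - x\<^sup>2) * (norm (\<gamma> b) - norm (\<gamma> a))"
        using radial_dist_mvt[of "norm (\<gamma> a)" "norm (\<gamma> b)"] n by auto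
      have sq: "0 \<le> 2 / (1 - y\<^sup>2)" if "0 \<le> y" "y < 1" for y :: real
        using that by (simp add: power_le_one)
      have "0 \<le> x" "x < 1" using x(1) n by (auto intro: order_trans[OF norm_ge_zero])
      then have "radial_dist (norm (\<gamma> b)) - radial_dist (norm (\<gamma> a)) \<ge> 0"
        unfolding x(2) using False by (intro mult_nonneg_nonneg sq) auto
      moreover have "0 \<le> 2 / (1 - (norm (\<gamma> a))\<^sup>2) * L"
        using L0 n by (intro mult_nonneg_nonneg sq) auto
      ultimately show ?thesis using ab unfolding L_def by (intro bexI[of _ a]) auto
    qed
  qed
  then show ?thesis by (simp add: pathstart_def pathfinish_def)
qed

text \<open>The curve follows the radius from \<open>z\<close> to the origin and then the radius to \<open>w\<close>.  The signed
  coordinate \<open>u\<close>, negative on the first radius and positive on the second, runs affinely from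
  \<open>- norm z\<close> to \<open>norm w\<close>, so the corner at the origin needs no case distinction: \<open>u\<close> bounds arc length,
  \<open>\<bar>u t\<bar>\<close> is the norm of \<open>\<gamma> t\<close>, and the hyperbolic length is at most the increment of
  \<^const>\<open>radial_dist\<close> along \<open>u\<close>.\<close>
lemma broken_radius_path:
  fixes z w :: "'a::real_normed_vector"
  assumes z: "norm z < 1" and w: "norm w < 1"
  shows "\<exists>\<gamma>. rectifiable_path \<gamma> \<and> path_image \<gamma> \<subseteq> ball 0 1 \<and> pathstart \<gamma> = z \<and> pathfinish \<gamma> = w \<and>
    arc_length_integral (\<lambda>\<xi>. 2 / (1 - (norm \<xi>)\<^sup>2)) \<gamma> \<le> radial_dist (norm z) + radial_dist (norm w)"
proof -
  define u where "u t = t * norm w - (1 - t) * norm z" for t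
  define \<gamma> where "\<gamma> t = max 0 (- u t) *\<^sub>R sgn z + max 0 (u t) *\<^sub>R sgn w" for t
  have u_diff: "u t - u s = (t - s) * (norm z + norm w)" for s t
    by (simp add: u_def algebra_simps)
  have u_mono: "u s \<le> u t" if "s \<le> t" for s t
  proof -
    have "0 \<le> (t - s) * (norm z + norm w)" using that by (intro mult_nonneg_nonneg) auto
    then show ?thesis using u_diff[of t s] by linarith
  qed
  have u01: "u 0 = - norm z" "u 1 = norm w" by (simp_all add: u_def)
  have u_bound: "- norm z \<le> u t" "u t \<le> norm w" if "t \<in> {0..1}" for t
    using u_mono[of 0 t] u_mono[of t 1] that u01 by auto
  have u_cont: "continuous_on A u" for A unfolding u_def by (intro continuous_intros)
  have polar: "norm x *\<^sub>R sgn x = x" for x :: 'a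
    by (cases "x = 0") (simp_all add: sgn_div_norm)
  have ends: "\<gamma> 0 = z" "\<gamma> 1 = w" by (simp_all add: \<gamma>_def u01 polar)
  have norm_\<gamma>: "norm (\<gamma> t) = \<bar>u t\<bar>" if "t \<in> {0..1}" for t
    using u_bound[OF that] by (auto simp: \<gamma>_def norm_sgn max_def)
  have "path \<gamma>" unfolding path_def \<gamma>_def by (intro continuous_intros u_cont)
  have dist_\<gamma>: "dist (\<gamma> s) (\<gamma> t) \<le> u t - u s" if "s \<le> t" for s t
  proof -
    have "\<gamma> s - \<gamma> t = (max 0 (- u s) - max 0 (- u t)) *\<^sub>R sgn z + (max 0 (u s) - max 0 (u t)) *\<^sub>R sgn w"
      by (simp add: \<gamma>_def algebra_simps)
    also have "norm \<dots> \<le> \<bar>max 0 (- u s) - max 0 (- u t)\<bar> * norm (sgn z) + \<bar>max 0 (u s) - max 0 (u t)\<bar> * norm (sgn w)"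
      by (rule norm_triangle_le) simp
    also have "\<dots> \<le> \<bar>max 0 (- u s) - max 0 (- u t)\<bar> * 1 + \<bar>max 0 (u s) - max 0 (u t)\<bar> * 1"
      by (intro add_mono mult_left_mono) (auto simp: norm_sgn)
    also have "\<dots> = u t - u s" using u_mono[OF that] by auto
    finally show ?thesis by (simp add: dist_norm)
  qed
  have le: "x \<le> u b - u a" if "x \<in> polygon_lengths \<gamma> a b" for a b x
    using polygon_length_le[OF _ that, of u] dist_\<gamma> by blast
  have bdd: "bdd_above (polygon_lengths \<gamma> 0 1)" using le by (auto simp: bdd_above_def)
  then have rect: "rectifiable_path \<gamma>" using \<open>path \<gamma>\<close> by (simp add: rectifiable_path_def)
  have sub: "path_image \<gamma> \<subseteq> ball 0 1"
  proof (clarsimp simp: path_image_def norm_\<gamma>)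
    fix t :: real assume "0 \<le> t" "t \<le> 1"
    then show "\<bar>u t\<bar> < 1" using u_bound[of t] z w by auto
  qed
  \<comment> \<open>Negating the density and \<^const>\<open>radial_dist\<close> turns the lower bound for integrals into an upper bound.\<close>
  have "- radial_dist (u 1) - - radial_dist (u 0) \<le> arc_length_integral (\<lambda>\<xi>. - (2 / (1 - (norm \<xi>)\<^sup>2))) \<gamma>"
  proof (rule arc_length_integral_ge[OF rect])
    show "continuous_on {0..1} (\<lambda>t. - (2 / (1 - (norm (\<gamma> t))\<^sup>2)))"
      using ball_density_continuous[OF \<open>path \<gamma>\<close> sub] by (rule continuous_on_minus)
    fix a b :: real assume ab: "0 \<le> a" "a \<le> b" "b \<le> 1"
    have u1: "\<bar>u t\<bar> < 1" if "t \<in> {0..1}" for t using u_bound[OF that] z w by auto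
    obtain x where x: "x \<in> {u a..u b}" "radial_dist (u b) - radial_dist (u a) = 2 / (1 - x\<^sup>2) * (u b - u a)"
      using radial_dist_mvt[of "u a" "u b"] u1 u_mono ab by (meson atLeastAtMost_iff order_trans)
    obtain c where c: "c \<in> {a..b}" "u c = x"
      using IVT'[of u a x b] x(1) ab u_cont by auto
    have "(norm (\<gamma> c))\<^sup>2 = x\<^sup>2" using norm_\<gamma>[of c] c ab by simp
    moreover have "0 \<le> 2 / (1 - x\<^sup>2)"
      using u1[of c] c ab by (simp add: abs_square_le_1)
    moreover have "Sup (polygon_lengths \<gamma> a b) \<le> u b - u a"
      using zero_in_polygon_lengths[OF ab(2)] by (intro cSup_least le) auto
    then have "arc_length \<gamma> b - arc_length \<gamma> a \<le> u b - u a"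
      using arc_length_add[OF bdd ab] by simp
    ultimately have "2 / (1 - (norm (\<gamma> c))\<^sup>2) * (arc_length \<gamma> b - arc_length \<gamma> a) \<le> 2 / (1 - x\<^sup>2) * (u b - u a)"
      by (metis mult_left_mono)
    then show "\<exists>c\<in>{a..b}. - radial_dist (u b) - - radial_dist (u a)
       \<le> - (2 / (1 - (norm (\<gamma> c))\<^sup>2)) * (arc_length \<gamma> b - arc_length \<gamma> a)"
      using c(1) x(2) by (intro bexI[of _ c]) auto
  qed
  then have "arc_length_integral (\<lambda>\<xi>. 2 / (1 - (norm \<xi>)\<^sup>2)) \<gamma> \<le> radial_dist (norm z) + radial_dist (norm w)"
    using z by (simp add: arc_length_integral_uminus u01 radial_dist_uminus)
  then show ?thesis using rect sub ends by (auto simp: pathstart_def pathfinish_def)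
qed

lemma rho_radial_bounds:
  assumes z: "norm z < 1" and w: "norm w < 1"
  shows "\<bar>rho z w - radial_dist (norm z)\<bar> \<le> radial_dist (norm w)"
proof -
  define S where "S = {arc_length_integral (\<lambda>\<xi>. 2 / (1 - (norm \<xi>)\<^sup>2)) \<gamma> | \<gamma>.
     rectifiable_path \<gamma> \<and> path_image \<gamma> \<subseteq> ball 0 1 \<and> pathstart \<gamma> = z \<and> pathfinish \<gamma> = w}"
  have rho: "rho z w = Inf S" by (simp add: rho_def S_def)
  have lower: "radial_dist (norm z) - radial_dist (norm w) \<le> l" if "l \<in> S" for l
    using that hyperbolic_length_ge unfolding S_def by blast
  obtain l where l: "l \<in> S" "l \<le> radial_dist (norm z) + radial_dist (norm w)"
    using broken_radius_path[OF z w] unfolding S_def by blast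
  have "radial_dist (norm z) - radial_dist (norm w) \<le> Inf S"
    using l lower by (intro cInf_greatest) auto
  moreover have "Inf S \<le> l" using l lower by (intro cInf_lower) (auto simp: bdd_below_def)
  ultimately show ?thesis using l rho by linarith
qed

text \<open>The difference between \<^const>\<open>radial_dist\<close> and \<open>- ln (1 - norm z)\<close> is \<open>ln (1 + norm z)\<close>, which lies
  between \<open>0\<close> and \<open>ln 2\<close>.\<close>
lemma rho_log_boundary_distance:
  assumes z: "norm z < 1" and w: "norm w < 1"
  shows "\<bar>rho z w + ln (1 - norm z)\<bar> \<le> radial_dist (norm w) + ln 2"
proof -
  have "radial_dist (norm z) = ln (1 + norm z) - ln (1 - norm z)"
    unfolding radial_dist_def
    by (rule ln_divide_pos) (use z in \<open>auto simp: add_pos_nonneg\<close>)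
  moreover have "0 < 1 + norm z" by (simp add: add_pos_nonneg)
  then have "0 \<le> ln (1 + norm z)" "ln (1 + norm z) \<le> ln 2"
    using z by auto
  ultimately show ?thesis using rho_radial_bounds[OF z w] by linarith
qed

section \<open>Koranyi regions\<close>

lemma herm_self: "herm z z = of_real ((norm z)\<^sup>2)"
  by (simp add: herm_def norm_vec_def L2_set_def complex_norm_square sum_nonneg
    del: of_real_power)

lemma norm_herm_le: "cmod (herm z w) \<le> norm z * norm w"
proof -
  have "cmod (herm z w) \<le> (\<Sum>j\<in>UNIV. \<bar>norm (z $ j)\<bar> * \<bar>norm (w $ j)\<bar>)"
    unfolding herm_def by (rule order_trans[OF norm_sum]) (simp add: norm_mult)
  also have "\<dots> \<le> norm z * norm w" unfolding norm_vec_def by (rule L2_set_mult_ineq)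
  finally show ?thesis .
qed

lemma tendsto_one_minus_herm:
  assumes "(z \<longlongrightarrow> \<tau>) F" "norm \<tau> = 1"
  shows "((\<lambda>k. cmod (1 - herm (z k) \<tau>)) \<longlongrightarrow> 0) F"
proof -
  have "((\<lambda>k. herm (z k) \<tau>) \<longlongrightarrow> herm \<tau> \<tau>) F"
    unfolding herm_def by (intro tendsto_intros tendsto_vec_nth assms)
  then have "((\<lambda>k. cmod (1 - herm (z k) \<tau>)) \<longlongrightarrow> cmod (1 - herm \<tau> \<tau>)) F"
    by (intro tendsto_intros)
  then show ?thesis using assms(2) by (simp add: herm_self)
qed

text \<open>The region is defined by one of the two inequalities between \<open>cmod (1 - herm z \<tau>)\<close> and \<open>1 - norm z\<close>;
  the other is the Cauchy--Schwarz inequality.\<close>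
lemma koranyi_boundary_distance:
  assumes z: "z \<in> koranyi \<tau> M" and \<tau>: "norm \<tau> = 1" and M: "1 < M"
  shows "\<bar>ln (cmod (1 - herm z \<tau>)) - ln (1 - norm z)\<bar> \<le> ln M"
proof -
  have n: "norm z < 1" "cmod (1 - herm z \<tau>) < M * (1 - norm z)"
    using z by (auto simp: koranyi_def)
  have "1 - norm z \<le> cmod 1 - cmod (herm z \<tau>)" using norm_herm_le[of z \<tau>] \<tau> by simp
  also have "\<dots> \<le> cmod (1 - herm z \<tau>)" by (rule norm_triangle_ineq2)
  finally have le: "1 - norm z \<le> cmod (1 - herm z \<tau>)" .
  then have "ln (1 - norm z) \<le> ln (cmod (1 - herm z \<tau>))"
    using n by (subst ln_le_cancel_iff) auto
  moreover have "ln (cmod (1 - herm z \<tau>)) \<le> ln (M * (1 - norm z))"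
    using n le M by (subst ln_le_cancel_iff) auto
  then have "ln (cmod (1 - herm z \<tau>)) \<le> ln M + ln (1 - norm z)"
    using n M by (simp add: ln_mult)
  ultimately show ?thesis by simp
qed

section \<open>Orbits that approach the boundary geometrically\<close>

text \<open>Up to a bounded term, \<open>ln (a k)\<close> is \<open>k ln \<alpha>\<close> plus the sum of the errors \<open>ln (1 + h i)\<close>.  Since \<open>a\<close>
  tends to \<open>0\<close>, the ratios are eventually at most some \<open>q < 1\<close>, so \<open>a\<close> decays geometrically; the
  errors, of size \<open>a i powr \<beta>\<close>, then decay geometrically too, and their sum converges.\<close>
lemma geometric_decay_log:
  fixes a h :: "nat \<Rightarrow> real"
  assumes pos: "\<forall>\<^sub>F k in sequentially. 0 < a k" and lim: "a \<longlonglongrightarrow> 0"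
    and \<alpha>: "0 < \<alpha>" "\<alpha> < 1" and \<beta>: "0 < \<beta>"
    and ratio: "\<forall>\<^sub>F k in sequentially. a (Suc k) / a k = \<alpha> * (1 + h k)"
    and h: "\<forall>\<^sub>F k in sequentially. \<bar>h k\<bar> \<le> C * a k powr \<beta>"
  shows "(\<lambda>k. ln (a k) - real k * ln \<alpha>) \<in> O(\<lambda>_. 1)"
proof -
  define q where "q = (1 + \<alpha>) / 2"
  have q: "0 < q" "q < 1" using \<alpha> by (auto simp: q_def)
  have "(\<lambda>k. a k powr \<beta>) \<longlonglongrightarrow> 0 powr \<beta>"
    by (rule tendsto_powr') (use lim pos \<beta> in \<open>auto elim!: eventually_mono\<close>)
  then have "(\<lambda>k. C * a k powr \<beta>) \<longlonglongrightarrow> 0" using \<beta> tendsto_mult_right_zero by fastforce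
  \<comment> \<open>The bound \<open>1/2\<close> makes \<open>ln (1 + h)\<close> comparable to \<open>h\<close>; the bound \<open>(1 - \<alpha>)/2\<close> keeps \<open>\<alpha> * (1 + h)\<close>
    below \<open>q\<close>.\<close>
  then have "\<forall>\<^sub>F k in sequentially. C * a k powr \<beta> < min (1/2) ((1 - \<alpha>)/2)"
    by (rule order_tendstoD) (use \<alpha> in auto)
  with pos ratio h have "\<forall>\<^sub>F k in sequentially. 0 < a k \<and> a (Suc k) / a k = \<alpha> * (1 + h k) \<and>
      \<bar>h k\<bar> \<le> C * a k powr \<beta> \<and> C * a k powr \<beta> < min (1/2) ((1 - \<alpha>)/2)"
    by eventually_elim auto
  then obtain N where N: "\<And>k. k \<ge> N \<Longrightarrow> 0 < a k" "\<And>k. k \<ge> N \<Longrightarrow> a (Suc k) / a k = \<alpha> * (1 + h k)"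
      "\<And>k. k \<ge> N \<Longrightarrow> \<bar>h k\<bar> \<le> C * a k powr \<beta>"
      "\<And>k. k \<ge> N \<Longrightarrow> \<bar>h k\<bar> < 1/2" "\<And>k. k \<ge> N \<Longrightarrow> \<bar>h k\<bar> < (1 - \<alpha>)/2"
    unfolding eventually_sequentially by fastforce
  have step: "a (Suc k) \<le> q * a k" if "k \<ge> N" for k
  proof -
    have "\<alpha> * h k \<le> \<alpha> * \<bar>h k\<bar>" using \<alpha> by (intro mult_left_mono) auto
    also have "\<dots> \<le> 1 * \<bar>h k\<bar>" using \<alpha> by (intro mult_right_mono) auto
    finally have "\<alpha> * h k \<le> \<bar>h k\<bar>" by simp
    then have "\<alpha> * (1 + h k) \<le> q" using N(5)[OF that] by (simp add: q_def algebra_simps)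
    then show ?thesis using N(1,2)[OF that] by (metis pos_divide_le_eq)
  qed
  have decay: "a (N + j) \<le> a N * q ^ j" for j
  proof (induction j)
    case (Suc j)
    have "a (N + Suc j) \<le> q * a (N + j)" using step by simp
    also have "\<dots> \<le> q * (a N * q ^ j)" using Suc q by (intro mult_left_mono) auto
    finally show ?case by (simp add: algebra_simps)
  qed simp
  define d where "d j = ln (a (N + j)) - real (N + j) * ln \<alpha>" for j
  have inc: "d (Suc j) - d j = ln (1 + h (N + j))" for j
  proof -
    have "a (N + Suc j) = \<alpha> * (1 + h (N + j)) * a (N + j)"
      using N(1,2)[of "N + j"] by (simp add: field_simps)
    moreover have "0 < 1 + h (N + j)" using N(4)[of "N + j"] by auto
    ultimately have "ln (a (N + Suc j)) = ln \<alpha> + ln (1 + h (N + j)) + ln (a (N + j))"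
      using \<alpha> N(1)[of "N + j"] by (simp add: ln_mult)
    then show ?thesis by (simp add: d_def algebra_simps)
  qed
  have C: "C \<ge> 0" using order_trans[OF abs_ge_zero N(3)[of N]] N(1)[of N] by (simp add: zero_le_mult_iff)
  have bound: "norm (d (Suc j) - d j) \<le> 2 * C * a N powr \<beta> * (q powr \<beta>) ^ j" for j
  proof -
    have x: "\<bar>h (N + j)\<bar> \<le> 1/2" using N(4)[of "N + j"] by simp
    then have "\<bar>ln (1 + h (N + j)) - h (N + j)\<bar> \<le> 2 * (h (N + j))\<^sup>2"
      by (rule abs_ln_one_plus_x_minus_x_bound)
    also have "2 * (h (N + j))\<^sup>2 = 2 * \<bar>h (N + j)\<bar> * \<bar>h (N + j)\<bar>" by (simp add: power2_eq_square)
    also have "\<dots> \<le> 1 * \<bar>h (N + j)\<bar>" using x by (intro mult_right_mono) auto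
    finally have "\<bar>ln (1 + h (N + j))\<bar> \<le> 2 * \<bar>h (N + j)\<bar>" by linarith
    also have "\<dots> \<le> 2 * (C * a (N + j) powr \<beta>)" using N(3)[of "N + j"] by simp
    also have "\<dots> \<le> 2 * (C * (a N * q ^ j) powr \<beta>)"
      using decay[of j] C \<beta> N(1)[of "N + j"] by (intro mult_left_mono powr_mono2) auto
    also have "(a N * q ^ j) powr \<beta> = a N powr \<beta> * (q powr \<beta>) ^ j"
      using q N(1)[of N] by (simp add: powr_mult powr_realpow[symmetric] powr_powr mult.commute)
    finally show ?thesis by (simp add: inc mult.assoc)
  qed
  have "q powr \<beta> < 1" using powr_less_mono2[of \<beta> q 1] q \<beta> by simp
  then have "summable (\<lambda>j. 2 * C * a N powr \<beta> * (q powr \<beta>) ^ j)"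
    by (intro summable_mult summable_geometric) simp
  then have "summable (\<lambda>j. d (Suc j) - d j)"
    using bound by (rule summable_comparison_test'[where N = 0])
  then have "convergent (\<lambda>n. \<Sum>j<n. d (Suc j) - d j)" by (simp add: summable_iff_convergent)
  then have "Bseq (\<lambda>n. d n - d 0)" by (simp add: sum_lessThan_telescope convergent_imp_Bseq)
  then obtain B where B: "\<And>n. norm (d n - d 0) \<le> B" by (auto simp: Bseq_def)
  show ?thesis
  proof (rule bigoI[where c = "B + \<bar>d 0\<bar>"], rule eventually_sequentiallyI[of N])
    fix k assume "N \<le> k"
    then obtain j where "k = N + j" using le_Suc_ex by blast
    then show "norm (ln (a k) - real k * ln \<alpha>) \<le> (B + \<bar>d 0\<bar>) * norm (1::real)"
      using B[of j] by (simp add: d_def)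
  qed
qed

theorem theorem4p12:
  fixes f :: "complex^'n \<Rightarrow> complex^'n" and \<tau> :: "complex^'n" and K \<alpha> \<beta> :: real
  assumes "1 \<le> K"
    and "quasiconformal_ball K f"
    and "\<forall>z\<in>ball 0 1. f z \<noteq> z"
    and "\<tau> \<in> sphere 0 1"
    and "0 < \<alpha>" "\<alpha> < 1"
    and "0 < \<beta>"
    and "\<forall>z\<in>ball 0 1. (\<lambda>k. (f ^^ k) z) \<longlonglongrightarrow> \<tau> \<and>
           (\<exists>M>1. \<forall>\<^sub>F k in sequentially. (f ^^ k) z \<in> koranyi \<tau> M)"
    and "\<forall>M>1. \<exists>h \<in> O[at \<tau> within koranyi \<tau> M](\<lambda>z. cmod (1 - herm z \<tau>) powr \<beta>).
           \<forall>\<^sub>F z in at \<tau> within koranyi \<tau> M.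
             cmod (1 - herm (f z) \<tau>) / cmod (1 - herm z \<tau>) = \<alpha> * (1 + h z)"
  shows "\<forall>z\<^sub>0\<in>ball 0 1. \<forall>w\<in>ball 0 1.
           (\<lambda>k. rho ((f ^^ k) z\<^sub>0) w - real k * ln (1 / \<alpha>)) \<in> O(\<lambda>_. 1)"
proof (intro ballI)
  fix z\<^sub>0 w :: "complex^'n" assume z\<^sub>0: "z\<^sub>0 \<in> ball 0 1" and w: "w \<in> ball 0 1"
  define z where "z k = (f ^^ k) z\<^sub>0" for k
  define a where "a k = cmod (1 - herm (z k) \<tau>)" for k
  have \<tau>: "norm \<tau> = 1" using assms(4) by simp
  obtain M where lim: "z \<longlonglongrightarrow> \<tau>" and M: "1 < M" and in_K: "\<forall>\<^sub>F k in sequentially. z k \<in> koranyi \<tau> M"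
    using assms(8) z\<^sub>0 unfolding z_def by blast
  obtain h where h_bigo: "h \<in> O[at \<tau> within koranyi \<tau> M](\<lambda>x. cmod (1 - herm x \<tau>) powr \<beta>)" and
    ratio: "\<forall>\<^sub>F x in at \<tau> within koranyi \<tau> M. cmod (1 - herm (f x) \<tau>) / cmod (1 - herm x \<tau>) = \<alpha> * (1 + h x)"
    using assms(9) M by blast
  from h_bigo obtain C where
    h: "\<forall>\<^sub>F x in at \<tau> within koranyi \<tau> M. norm (h x) \<le> C * norm (cmod (1 - herm x \<tau>) powr \<beta>)"
    by (rule landau_o.bigE)
  have approach: "filterlim z (at \<tau> within koranyi \<tau> M) sequentially"
    unfolding filterlim_at
  proof (intro conjI)
    show "\<forall>\<^sub>F k in sequentially. z k \<in> koranyi \<tau> M \<and> z k \<noteq> \<tau>"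
      using in_K by eventually_elim (use \<tau> in \<open>auto simp: koranyi_def\<close>)
  qed (rule lim)
  have "(\<lambda>k. ln (a k) - real k * ln \<alpha>) \<in> O(\<lambda>_. 1)"
  proof (rule geometric_decay_log)
    show "\<forall>\<^sub>F k in sequentially. 0 < a k" using in_K
    proof eventually_elim
      case (elim k)
      then have "norm (z k) < 1" by (simp add: koranyi_def)
      then have "cmod (herm (z k) \<tau>) < 1" using norm_herm_le[of "z k" \<tau>] \<tau> by simp
      then show ?case by (auto simp: a_def)
    qed
    show "a \<longlonglongrightarrow> 0" unfolding a_def by (rule tendsto_one_minus_herm[OF lim \<tau>])
    show "\<forall>\<^sub>F k in sequentially. a (Suc k) / a k = \<alpha> * (1 + h (z k))"
      using eventually_compose_filterlim[OF ratio approach] by (simp add: a_def z_def)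
    show "\<forall>\<^sub>F k in sequentially. \<bar>h (z k)\<bar> \<le> C * a k powr \<beta>"
      using eventually_compose_filterlim[OF h approach] by (simp add: a_def)
  qed (use assms in auto)
  moreover have "(\<lambda>k. rho (z k) w + ln (a k)) \<in> O(\<lambda>_. 1)"
  proof (rule bigoI)
    show "\<forall>\<^sub>F k in sequentially. norm (rho (z k) w + ln (a k))
        \<le> (radial_dist (norm w) + ln 2 + ln M) * norm (1::real)"
      using in_K
    proof eventually_elim
      case (elim k)
      then have "norm (z k) < 1" by (simp add: koranyi_def)
      then show ?case
        using rho_log_boundary_distance[of "z k" w] koranyi_boundary_distance[OF elim \<tau> M] w
        by (simp add: a_def)
    qed
  qed
  ultimately have "(\<lambda>k. (rho (z k) w + ln (a k)) - (ln (a k) - real k * ln \<alpha>)) \<in> O(\<lambda>_. 1)"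
    by (rule sum_in_bigo(2)[rotated])
  then show "(\<lambda>k. rho ((f ^^ k) z\<^sub>0) w - real k * ln (1 / \<alpha>)) \<in> O(\<lambda>_. 1)"
    using assms(5) by (simp add: z_def ln_div)
qed

end
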